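(* Let $m\ge1$ and $q=6m$. If $N(4,q,1)=\dfrac{q^2(q+2)}{4}$, then $N(4,2q,1)=\dfrac{(2q)^2(2q+2)}{4}$.
   Context: $B_q=\{0,\dots,q-1\}$ and $B_q^4$ is the set of words of length 4 over $B_q$. $N(4,q,1)$ is the maximum cardinality of a code $C\subseteq B_q^4$ capable of correcting single deletions, i.e. such that the sets $\lfloor x\rfloor_1$ ($x\in C$) of words obtained from $x$ by deleting one letter are pairwise disjoint (equivalently, the minimum deletion–insertion distance between distinct codewords exceeds 2). *)

theory Defs
  imports Main "HOL-Library.Sublist"
begin

definition words :: "nat \<Rightarrow> nat \<Rightarrow> nat list set" where
  "words n q = {x. length x = n \<and> set x \<subseteq> {0..<q}}"

definition del_ball :: "nat \<Rightarrow> nat list \<Rightarrow> nat list set" where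
  "del_ball s x = {y. subseq y x \<and> length y + s = length x}"

definition del_code :: "nat \<Rightarrow> nat \<Rightarrow> nat \<Rightarrow> nat list set \<Rightarrow> bool" where
  "del_code n q s C \<longleftrightarrow> C \<subseteq> words n q \<and>
     (\<forall>x\<in>C. \<forall>y\<in>C. x \<noteq> y \<longrightarrow> del_ball s x \<inter> del_ball s y = {})"

definition N :: "nat \<Rightarrow> nat \<Rightarrow> nat \<Rightarrow> nat" where
  "N n q s = Max {card C | C. del_code n q s C}"

end

theory Submission
  imports Defs "HOL-Number_Theory.Cong"
begin

text \<open>
  Upper bound: give a word of length 3 with 3, 2, 1 runs the weight 1, 2, 4. The deletion ball of
  every word of length 4 has weight at least 4, and a parity argument saves one further unit
  for each letter.

  Lower bound: split the doubled alphabet into two halves and put a copy of the given code on each.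
  Colour the ordered pairs of distinct letters of a half with \<open>2 * q - 2\<close> colours such
  that every colour class is a perfect matching (an oriented 1-factorisation of the complete
  graph), and the pairs \<open>(a, a)\<close> with one more colour. With \<open>s\<close> and \<open>s'\<close> the two halves in
  either order, add the words \<open>a b c d\<close> of shape \<open>s s s' s'\<close> whose pairs \<open>(a, b)\<close> and
  \<open>(c, d)\<close> have the same colour \<open>\<ge> q\<close>, and those of shape \<open>s s' s' s\<close> whose pair \<open>(b, c)\<close> has
  colour \<open>(a + d) mod q\<close>. The deletion balls of the added words partition the words of length 3
  that meet both halves.
\<close>

section \<open>Words of length three and four\<close>

lemma del_ball_4:
  "del_ball 1 [a, b, c, d] = {[b, c, d], [a, c, d], [a, b, d], [a, b, c]}"
proof -
  have "y \<in> del_ball 1 [a, b, c, d] \<longleftrightarrow>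
        y \<in> {[b, c, d], [a, c, d], [a, b, d], [a, b, c]}" for y
  proof (cases "length y = 3")
    case True
    then obtain u v w where "y = [u, v, w]"
      by (auto simp: numeral_3_eq_3 length_Suc_conv)
    then show ?thesis
      by (cases "u = a"; cases "v = b"; cases "w = c"; simp add: del_ball_def subseq_Cons2_iff)
  qed (auto simp: del_ball_def)
  then show ?thesis by blast
qed

lemma words_4E:
  assumes "x \<in> words 4 q"
  obtains a b c d where "x = [a, b, c, d]" "a < q" "b < q" "c < q" "d < q"
proof -
  from assms obtain a b c d where "x = [a, b, c, d]"
    by (auto simp: words_def eval_nat_numeral length_Suc_conv)
  with assms show thesis
    by (intro that[of a b c d]) (auto simp: words_def)
qed

lemma finite_words: "finite (words n q)"
  using finite_lists_length_eq[of "{0..<q}" n] by (simp add: words_def conj_commute)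

text \<open>The index triple lists the middle letter first: with \<open>b\<close> fixed, the weight
  of \<open>[a, b, c]\<close> factors into a term in \<open>a\<close> and a term in
  \<open>c\<close>.\<close>

lemma words_3_eq:
  "words 3 q = (\<lambda>(b, a, c). [a, b, c]) ` ({..<q} \<times> {..<q} \<times> {..<q})"
proof -
  have "y \<in> words 3 q \<longleftrightarrow> y \<in> (\<lambda>(b, a, c). [a, b, c]) ` ({..<q} \<times> {..<q} \<times> {..<q})" for y
    by (auto simp: words_def numeral_3_eq_3 length_Suc_conv image_iff)
  then show ?thesis by blast
qed

lemma del_ball_4_subset_words:
  assumes "x \<in> words 4 q" shows "del_ball 1 x \<subseteq> words 3 q"
  using assms by (elim words_4E) (auto simp: del_ball_4 words_def simp del: One_nat_def)

lemma finite_del_ball_4: "x \<in> words 4 q \<Longrightarrow> finite (del_ball 1 x)"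
  using del_ball_4_subset_words finite_words finite_subset by blast

lemma del_ball_map_4:
  assumes "x \<in> words 4 q" shows "del_ball 1 (map f x) = map f ` del_ball 1 x"
  using assms by (elim words_4E) (simp add: del_ball_4 del: One_nat_def)

lemma finite_code_cards: "finite {card C | C. del_code n q s C}"
proof -
  have "{card C | C. del_code n q s C} \<subseteq> card ` Pow (words n q)"
    by (auto simp: del_code_def)
  then show ?thesis
    using finite_words finite_subset by blast
qed

lemma ex_optimal_code: "\<exists>C. del_code n q s C \<and> card C = N n q s"
proof -
  have "{card C | C. del_code n q s C} \<noteq> {}"
    by (auto simp: del_code_def intro!: exI[of _ "{}"])
  from Max_in[OF finite_code_cards this] show ?thesis
    by (auto simp: N_def)
qed

lemma card_le_N: "del_code n q s C \<Longrightarrow> card C \<le> N n q s"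
  unfolding N_def by (intro Max_ge finite_code_cards) blast

section \<open>The upper bound for even alphabets\<close>

fun weight3 :: "nat list \<Rightarrow> nat" where
  "weight3 [a, b, c] = (if a = b then 2 else 1) * (if b = c then 2 else 1)"
| "weight3 _ = 0"

text \<open>For \<open>v < q\<close> these are the words of weight 1 with middle letter
  \<open>v\<close>; \<open>a = c\<close> is allowed, since only runs count.\<close>

definition middle :: "nat \<Rightarrow> nat \<Rightarrow> nat list set" where
  "middle q v = {[a, v, c] | a c. a < q \<and> c < q \<and> a \<noteq> v \<and> c \<noteq> v}"

lemma sum_one_if_eq:
  fixes b :: nat
  assumes "b < q" shows "(\<Sum>a<q. if a = b then 2 else 1) = q + (1::nat)"
proof -
  have "(\<Sum>a<q. if a = b then 2 else 1) = (\<Sum>a<q. 1 + (if a = b then 1 else (0::nat)))"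
    by (intro sum.cong) auto
  also have "\<dots> = q + 1"
    using assms unfolding sum.distrib by (simp add: sum.delta)
  finally show ?thesis .
qed

lemma sum_weight3: "sum weight3 (words 3 q) = q * (q + 1) ^ 2"
proof -
  have "sum weight3 (words 3 q) =
        (\<Sum>(b, a, c) \<in> {..<q} \<times> {..<q} \<times> {..<q}. weight3 [a, b, c])"
    unfolding words_3_eq by (subst sum.reindex) (auto simp: inj_on_def case_prod_beta)
  also have "\<dots> = (\<Sum>b<q. (\<Sum>a<q. if a = b then 2 else 1) * (\<Sum>c<q. if c = b then 2 else 1))"
    by (simp add: sum.cartesian_product[symmetric] sum_product eq_commute)
  also have "\<dots> = (\<Sum>b<q. (q + 1) * (q + 1))"
    by (intro sum.cong refl) (simp add: sum_one_if_eq)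
  finally show ?thesis by (simp add: power2_eq_square)
qed

lemma middle_eq_image:
  "middle q v = (\<lambda>(a, c). [a, v, c]) ` (({..<q} - {v}) \<times> ({..<q} - {v}))"
  unfolding middle_def by auto

lemma card_middle: "v < q \<Longrightarrow> card (middle q v) = (q - 1) ^ 2"
  unfolding middle_eq_image
  by (subst card_image) (auto simp: inj_on_def card_cartesian_product power2_eq_square)

lemma middle_subset_words: "v < q \<Longrightarrow> middle q v \<subseteq> words 3 q"
  by (auto simp: middle_def words_def)

lemma finite_middle: "finite (middle q v)"
  unfolding middle_eq_image by simp

lemma middle_disjoint: "v \<noteq> w \<Longrightarrow> middle q v \<inter> middle q w = {}"
  by (auto simp: middle_def)

lemma weight3_middle: "y \<in> middle q v \<Longrightarrow> weight3 y = 1"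
  by (auto simp: middle_def)

lemma weight3_del_ball:
  assumes "x \<in> words 4 q"
  shows "4 + (\<Sum>v<q. card (del_ball 1 x \<inter> middle q v) mod 2) \<le> sum weight3 (del_ball 1 x)"
proof -
  from assms obtain a b c d where x: "x = [a, b, c, d]" and l: "a < q" "b < q" "c < q" "d < q"
    by (rule words_4E)
  let ?t = "\<lambda>v. card (del_ball 1 x \<inter> middle q v) mod 2"
  \<comment> \<open>A deletion leaves \<open>b\<close> or \<open>c\<close> in the middle, so no
    other letter contributes.\<close>
  have "(\<Sum>v<q. ?t v) = (\<Sum>v\<in>{b, c}. ?t v)"
    using l by (intro sum.mono_neutral_right) (auto simp: x del_ball_4 middle_def simp del: One_nat_def)
  moreover have mid: "[u, v, w] \<in> middle q z \<longleftrightarrow> v = z \<and> u < q \<and> w < q \<and> u \<noteq> z \<and> w \<noteq> z"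
    for u v w z by (auto simp: middle_def)
  \<comment> \<open>With four runs, \<open>a \<noteq> c\<close> and \<open>b \<noteq> d\<close>, the
    weight is 4 and both counts are 2; each of \<open>a = c\<close> and \<open>b = d\<close> adds
    one to the weight and makes one count odd. Fewer runs are checked case by case.\<close>
  have "4 + (\<Sum>v\<in>{b, c}. ?t v) \<le> sum weight3 (del_ball 1 x)"
    unfolding x del_ball_4 using l
    by (cases "a = b"; cases "b = c"; cases "c = d"; cases "a = c"; cases "b = d"; cases "a = d";
        simp add: mid Int_insert_left sum.insert_if card_insert_if split del: if_split)
  ultimately show ?thesis by simp
qed

text \<open>
  Levenshtein's weighting gives \<open>4 * card C \<le> q * (q + 1)\<^sup>2\<close>. The number \<open>(q - 1)\<^sup>2\<close> of words in
  \<open>middle q v\<close> is odd, whereas a codeword of weight exactly 4 covers an even number of them;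
  so every letter \<open>v\<close> costs at least one unit of weight.
\<close>

lemma code_card_upper:
  assumes C: "del_code 4 q 1 C" and "even q"
  shows "4 * card C \<le> q ^ 2 * (q + 2)"
proof -
  define U where "U = (\<Union>x\<in>C. del_ball 1 x)"
  let ?t = "\<lambda>x v. card (del_ball 1 x \<inter> middle q v)"
  have CW: "C \<subseteq> words 4 q" and
    disj: "\<And>x y. x \<in> C \<Longrightarrow> y \<in> C \<Longrightarrow> x \<noteq> y \<Longrightarrow> del_ball 1 x \<inter> del_ball 1 y = {}"
    using C by (auto simp: del_code_def)
  have fC: "finite C" using CW finite_words finite_subset by blast
  have fB: "finite (del_ball 1 x)" if "x \<in> C" for x
    using that CW finite_del_ball_4 by blast
  have UW: "U \<subseteq> words 3 q"
    using CW del_ball_4_subset_words unfolding U_def by blast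
  \<comment> \<open>Otherwise the disjoint balls would cut the odd set \<open>middle q v\<close>
    into even pieces.\<close>
  have parity: "1 \<le> (\<Sum>x\<in>C. ?t x v mod 2) + card (middle q v - U)" if v: "v < q" for v
  proof (rule ccontr)
    assume "\<not> ?thesis"
    then have z: "(\<Sum>x\<in>C. ?t x v mod 2) = 0" "card (middle q v - U) = 0" by auto
    then have "middle q v \<subseteq> U" using finite_middle by (simp add: card_eq_0_iff)
    then have "middle q v = (\<Union>x\<in>C. del_ball 1 x \<inter> middle q v)" by (auto simp: U_def)
    moreover have "card (\<Union>x\<in>C. del_ball 1 x \<inter> middle q v) = (\<Sum>x\<in>C. ?t x v)"
      using disj fC fB by (intro card_UN_disjoint) blast+
    ultimately have "card (middle q v) = (\<Sum>x\<in>C. ?t x v)" by metis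
    moreover have "even (\<Sum>x\<in>C. ?t x v)"
      using z(1) fC by (intro dvd_sum) (simp add: even_iff_mod_2_eq_zero)
    moreover have "odd ((q - 1) ^ 2)"
      using v \<open>even q\<close> by (cases q) auto
    ultimately show False
      using v by (metis card_middle)
  qed
  have "4 * card C + (\<Sum>x\<in>C. \<Sum>v<q. ?t x v mod 2) =
        (\<Sum>x\<in>C. 4 + (\<Sum>v<q. ?t x v mod 2))"
    by (simp add: sum.distrib)
  also have "\<dots> \<le> (\<Sum>x\<in>C. sum weight3 (del_ball 1 x))"
    using CW weight3_del_ball by (intro sum_mono) blast
  also have "\<dots> = sum weight3 U"
    unfolding U_def using fC fB disj by (subst sum.UNION_disjoint) auto
  finally have covered: "4 * card C + (\<Sum>x\<in>C. \<Sum>v<q. ?t x v mod 2) \<le> sum weight3 U" .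
  \<comment> \<open>Missed words of weight 1 are charged to the weight outside \<open>U\<close>, so
    both kinds of loss draw on the same total.\<close>
  have "(\<Sum>v<q. card (middle q v - U)) = card (\<Union>v<q. middle q v - U)"
    using finite_middle middle_disjoint by (subst card_UN_disjoint) (simp_all, blast)
  also have "\<dots> = sum weight3 (\<Union>v<q. middle q v - U)"
    unfolding card_eq_sum using weight3_middle by (intro sum.cong) auto
  also have "\<dots> \<le> sum weight3 (words 3 q - U)"
    using finite_words middle_subset_words by (intro sum_mono2) (blast | simp)+
  finally have "sum weight3 U + (\<Sum>v<q. card (middle q v - U)) \<le> q * (q + 1) ^ 2"
    using sum.subset_diff[OF UW finite_words, of weight3] by (simp add: sum_weight3)
  moreover have "q \<le> (\<Sum>x\<in>C. \<Sum>v<q. ?t x v mod 2) + (\<Sum>v<q. card (middle q v - U))"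
  proof -
    have "(\<Sum>v<q. 1) \<le> (\<Sum>v<q. (\<Sum>x\<in>C. ?t x v mod 2) + card (middle q v - U))"
      using parity by (intro sum_mono) auto
    then show ?thesis
      by (simp add: sum.distrib sum.swap[of _ C])
  qed
  ultimately have "4 * card C + q \<le> q * (q + 1) ^ 2"
    using covered by linarith
  \<comment> \<open>One unit per letter is exactly the gap between Levenshtein's bound and the
    claim.\<close>
  moreover have "q * (q + 1) ^ 2 = q ^ 2 * (q + 2) + q"
    by (simp add: power2_eq_square algebra_simps)
  ultimately show ?thesis by simp
qed

section \<open>Colouring ordered pairs\<close>

text \<open>The classical 1-factorisation of the complete graph on \<open>n + 1\<close> vertices for
  odd \<open>n\<close>, with \<open>n\<close> as the point at infinity.\<close>

definition round_robin :: "nat \<Rightarrow> nat \<Rightarrow> nat \<Rightarrow> nat" where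
  "round_robin n a b =
     (if a = n then 2 * b else if b = n then 2 * a else a + b) mod n"

lemma round_robin_commute: "round_robin n a b = round_robin n b a"
  by (auto simp: round_robin_def add.commute)

lemma add_mod_left_cancel:
  fixes a b c n :: nat
  assumes "(a + b) mod n = (a + c) mod n" "b < n" "c < n"
  shows "b = c"
  using assms by (metis cong_add_lcancel_nat cong_def mod_less)

text \<open>At a vertex \<open>a < n\<close> the sums \<open>a + b\<close> with
  \<open>b \<noteq> a\<close> miss only the residue \<open>2 * a\<close>, which the edge to
  \<open>n\<close> takes; at \<open>n\<close> itself, 2 is invertible modulo the odd
  \<open>n\<close>.\<close>

lemma round_robin_cancel:
  assumes "odd n" "a \<le> n" "b \<le> n" "b' \<le> n" "a \<noteq> b" "a \<noteq> b'"
    and eq: "round_robin n a b = round_robin n a b'"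
  shows "b = b'"
proof (cases "a = n")
  case True
  then have "(2 * b) mod n = (2 * b') mod n" "b < n" "b' < n"
    using assms by (auto simp: round_robin_def)
  moreover have "coprime 2 n" using \<open>odd n\<close> by simp
  ultimately show ?thesis
    by (metis cong_def cong_mult_lcancel_nat mod_less)
next
  case False
  with assms show ?thesis
    using add_mod_left_cancel[of a b n b'] add_mod_left_cancel[of a a n b']
      add_mod_left_cancel[of a b n a]
    by (auto simp: round_robin_def mult_2 split: if_splits)
qed

lemma ex_pair_colouring:
  assumes "even q" "q > 0"
  obtains col :: "nat \<Rightarrow> nat \<Rightarrow> nat" where
    "\<And>a b. a < q \<Longrightarrow> b < q \<Longrightarrow> col a b < 2 * q - 1"
    "\<And>a b a' b'. \<lbrakk>a < q; b < q; a' < q; b' < q; col a b = col a' b';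
        a = a' \<or> a = b' \<or> b = a' \<or> b = b'\<rbrakk> \<Longrightarrow> a = a' \<and> b = b'"
    "\<And>k. k < 2 * q - 2 \<Longrightarrow> card {(a, b). a < q \<and> b < q \<and> col a b = k} = q div 2"
    "card {(a, b). a < q \<and> b < q \<and> col a b = 2 * q - 2} = q"
proof -
  define n where "n = q - 1"
  have q: "q = n + 1" and "odd n" using assms by (auto simp: n_def)
  then have n: "n > 0" by (auto intro: odd_pos)
  \<comment> \<open>The parity bit separates \<open>(a, b)\<close> from \<open>(b, a)\<close>, which
    \<open>round_robin\<close> colours alike; \<open>2 * n\<close> lies above every off-diagonal
    colour.\<close>
  define col where "col = (\<lambda>a b. if a = b then 2 * n
    else 2 * round_robin n a b + (if a < b then 1 else 0))"
  define P where "P = (\<lambda>k. {(a, b). a < q \<and> b < q \<and> col a b = k})"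
  have rr: "round_robin n a b < n" for a b
    using n by (simp add: round_robin_def)
  have col_off: "col a b < 2 * n" if "a \<noteq> b" for a b
    using that rr[of a b] by (simp add: col_def)
  have col_diag: "col a b = 2 * n \<longleftrightarrow> a = b" for a b
    using col_off[of a b] by (cases "a = b") (simp_all add: col_def)
  have col_eq: "round_robin n a b = round_robin n a' b' \<and> (a < b \<longleftrightarrow> a' < b')"
    if "a \<noteq> b" "a' \<noteq> b'" "col a b = col a' b'" for a b a' b'
    using that by (auto simp: col_def split: if_splits) presburger+
  have pack: "a = a' \<and> b = b'"
    if l: "a < q" "b < q" "a' < q" "b' < q" and c: "col a b = col a' b'"
      and s: "a = a' \<or> a = b' \<or> b = a' \<or> b = b'" for a b a' b'
  proof (cases "a = b \<or> a' = b'")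
    case True
    then have "a = b \<and> a' = b'"
      using c col_diag by metis
    with s show ?thesis by auto
  next
    case False
    then have ne: "a \<noteq> b" "a' \<noteq> b'" by auto
    note e = col_eq[OF ne c]
    note cancel = round_robin_cancel[OF \<open>odd n\<close>]
    from s consider "a = a'" | "b = b'" | "a = b'" | "b = a'" by blast
    then show ?thesis
    proof cases
      case 1
      then show ?thesis using e ne l cancel[of a b b'] by (auto simp: q)
    next
      case 2
      then show ?thesis using e ne l cancel[of b a a']
        by (auto simp: q round_robin_commute)
    next
      \<comment> \<open>Cancellation gives \<open>b = a'\<close>, so the pairs are reverses of each
        other, which their equal orientation forbids.\<close>
      case 3
      then show ?thesis using e ne l cancel[of a b a']
        by (auto simp: q round_robin_commute)
    next
      case 4
      then show ?thesis using e ne l cancel[of b a b']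
        by (auto simp: q round_robin_commute)
    qed
  qed
  have Psub: "P k \<subseteq> {..<q} \<times> {..<q}" for k by (auto simp: P_def)
  have fP: "finite (P k)" for k using Psub finite_subset by blast
  \<comment> \<open>Each class is a matching, hence has at most \<open>q div 2\<close> pairs; since the \<open>2 * n\<close> classes
      exhaust all \<open>q * n\<close> pairs of distinct letters, equality holds in each.\<close>
  have le: "card (P k) \<le> q div 2" if "k < 2 * n" for k
  proof -
    have "inj_on fst (P k)" "inj_on snd (P k)"
      using pack by (auto simp: inj_on_def P_def)
    then have "card (fst ` P k) = card (P k)" "card (snd ` P k) = card (P k)"
      by (simp_all add: card_image)
    moreover have "fst ` P k \<inter> snd ` P k = {}"
    proof -
      have False if "(a, b) \<in> P k" "(c, a) \<in> P k" for a b c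
      proof -
        have "a = c \<and> b = a" using that pack[of a b c a] by (auto simp: P_def)
        with that \<open>k < 2 * n\<close> show False by (auto simp: P_def col_def)
      qed
      then show ?thesis by auto
    qed
    moreover have "card (fst ` P k \<union> snd ` P k) \<le> card {..<q}"
      by (intro card_mono) (auto simp: P_def)
    ultimately show ?thesis
      using fP[of k] by (simp add: card_Un_disjoint)
  qed
  have diag: "P (2 * n) = (\<lambda>a. (a, a)) ` {..<q}"
    by (auto simp: P_def col_diag)
  have "card (P (2 * n)) = q"
    unfolding diag by (subst card_image) (auto simp: inj_on_def)
  have "(\<Sum>k<2 * n. card (P k)) = card (\<Union>k<2 * n. P k)"
    using fP by (subst card_UN_disjoint) (auto simp: P_def)
  also have "(\<Union>k<2 * n. P k) = {..<q} \<times> {..<q} - P (2 * n)"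
  proof -
    have "col a b < 2 * n \<longleftrightarrow> a \<noteq> b" for a b
      using col_off col_diag by (metis less_irrefl)
    then show ?thesis by (auto simp: P_def col_diag)
  qed
  also have "card \<dots> = n * q"
    using \<open>card (P (2 * n)) = q\<close> fP Psub by (simp add: card_Diff_subset q)
  also have "\<dots> = n * (2 * (q div 2))"
    using \<open>even q\<close> by simp
  also have "\<dots> = (\<Sum>k<2 * n. q div 2)"
    by simp
  finally have sum_eq: "(\<Sum>k<2 * n. card (P k)) = (\<Sum>k<2 * n. q div 2)" .
  have cP: "card (P k) = q div 2" if "k < 2 * n" for k
    using sum_mono_inv[OF sum_eq le, of k] that by auto
  have q2: "2 * q - 2 = 2 * n" by (simp add: q)
  show thesis
  proof (rule that[of col])
    show "col a b < 2 * q - 1" for a b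
      using col_off[of a b] col_diag[of a b] by (cases "a = b") (simp_all add: q)
    show "a = a' \<and> b = b'"
      if "a < q" "b < q" "a' < q" "b' < q" "col a b = col a' b'"
        "a = a' \<or> a = b' \<or> b = a' \<or> b = b'" for a b a' b'
      using that by (rule pack)
    show "card {(a, b). a < q \<and> b < q \<and> col a b = k} = q div 2" if "k < 2 * q - 2" for k
      using cP[of k] that unfolding P_def q2 by blast
    show "card {(a, b). a < q \<and> b < q \<and> col a b = 2 * q - 2} = q"
      using \<open>card (P (2 * n)) = q\<close> unfolding P_def q2 by blast
  qed
qed

section \<open>Doubling the alphabet\<close>

text \<open>A Boolean index lets \<open>\<not> s\<close> name the other half, so both orders of the
  halves are treated at once.\<close>

definition letter :: "nat \<Rightarrow> bool \<Rightarrow> nat \<Rightarrow> nat" where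
  "letter q s a = (if s then a + q else a)"

lemma letter_eq_iff [simp]:
  "a < q \<Longrightarrow> b < q \<Longrightarrow> letter q s a = letter q t b \<longleftrightarrow> s = t \<and> a = b"
  by (auto simp: letter_def)

lemma letter_less [simp]: "a < q \<Longrightarrow> letter q s a < 2 * q"
  by (auto simp: letter_def)

text \<open>The summands count the two copies of \<open>C\<close>, the words of shape
  \<open>s s s' s'\<close> with off-diagonal and with diagonal colour, and those of shape
  \<open>s s' s' s\<close>.\<close>

lemma code_doubling:
  assumes C: "del_code 4 q 1 C" and "even q" "q > 0"
  obtains D where "del_code 4 (2 * q) 1 D"
    "card D = 2 * card C + q ^ 2 * (q - 2) div 2 + 2 * q ^ 2 + q ^ 3"
proof -
  obtain col :: "nat \<Rightarrow> nat \<Rightarrow> nat" where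
    col_less: "\<And>a b. a < q \<Longrightarrow> b < q \<Longrightarrow> col a b < 2 * q - 1" and
    pack: "\<And>a b a' b'. \<lbrakk>a < q; b < q; a' < q; b' < q; col a b = col a' b';
        a = a' \<or> a = b' \<or> b = a' \<or> b = b'\<rbrakk> \<Longrightarrow> a = a' \<and> b = b'" and
    cardP: "\<And>k. k < 2 * q - 2 \<Longrightarrow> card {(a, b). a < q \<and> b < q \<and> col a b = k} = q div 2" and
    cardP_diag: "card {(a, b). a < q \<and> b < q \<and> col a b = 2 * q - 2} = q"
    using ex_pair_colouring[OF \<open>even q\<close> \<open>q > 0\<close>] by blast
  define P where "P = (\<lambda>k. {(a, b). a < q \<and> b < q \<and> col a b = k})"
  \<comment> \<open>Of the \<open>2 * q - 1\<close> colours, the \<open>q\<close> lowest serve as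
    residues in \<open>J\<close> and the other \<open>q - 1\<close> are reserved for
    \<open>I\<close>.\<close>
  define I where "I = (\<Union>k\<in>{q..2 * q - 2}. P k \<times> P k)"
  define J where "J = (SIGMA ab : {..<q} \<times> {..<q}. P ((fst ab + snd ab) mod q))"
  define f where "f = (\<lambda>s ((a, b), (c, d)).
    [letter q s a, letter q s b, letter q (\<not> s) c, letter q (\<not> s) d])"
  define g where "g = (\<lambda>s ((a, b), (c, d)).
    [letter q s a, letter q (\<not> s) c, letter q (\<not> s) d, letter q s b])"
  define K where "K = (\<lambda>s. map (letter q s) ` C)"
  define F where "F = (\<lambda>s. f s ` I)"
  define G where "G = (\<lambda>s. g s ` J)"
  have CW: "C \<subseteq> words 4 q" and
    disj: "\<And>x y. x \<in> C \<Longrightarrow> y \<in> C \<Longrightarrow> x \<noteq> y \<Longrightarrow> del_ball 1 x \<inter> del_ball 1 y = {}"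
    using C by (auto simp: del_code_def)
  have fC: "finite C" using CW finite_words finite_subset by blast
  have fP: "finite (P k)" for k
    by (rule finite_subset[of _ "{..<q} \<times> {..<q}"]) (auto simp: P_def)

  have FE: "\<exists>a b c d. x = [letter q s a, letter q s b, letter q (\<not> s) c, letter q (\<not> s) d] \<and>
      a < q \<and> b < q \<and> c < q \<and> d < q \<and> col a b = col c d \<and> q \<le> col a b \<and> q \<le> col c d"
    if "x \<in> F s" for x s
  proof -
    obtain a b c d k where "x = f s ((a, b), (c, d))" "(a, b) \<in> P k" "(c, d) \<in> P k" "q \<le> k"
      using \<open>x \<in> F s\<close> by (auto simp: F_def I_def)
    then show ?thesis
      by (intro exI[of _ a] exI[of _ b] exI[of _ c] exI[of _ d]) (auto simp: f_def P_def)
  qed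
  have GE: "\<exists>a b c d. x = [letter q s a, letter q (\<not> s) c, letter q (\<not> s) d, letter q s b] \<and>
      a < q \<and> b < q \<and> c < q \<and> d < q \<and> col c d = (a + b) mod q \<and> col c d < q"
    if "x \<in> G s" for x s
  proof -
    obtain a b c d where "x = g s ((a, b), (c, d))" "a < q" "b < q" "(c, d) \<in> P ((a + b) mod q)"
      using \<open>x \<in> G s\<close> by (auto simp: G_def J_def)
    then show ?thesis using \<open>q > 0\<close>
      by (intro exI[of _ a] exI[of _ b] exI[of _ c] exI[of _ d]) (auto simp: g_def P_def)
  qed
  have KE: "\<exists>a b c d. x = [letter q s a, letter q s b, letter q s c, letter q s d] \<and>
      a < q \<and> b < q \<and> c < q \<and> d < q" if "x \<in> K s" for x s
  proof -
    obtain y where y: "x = map (letter q s) y" "y \<in> words 4 q"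
      using \<open>x \<in> K s\<close> CW by (auto simp: K_def)
    from y(2) obtain a b c d where "y = [a, b, c, d]" "a < q" "b < q" "c < q" "d < q"
      by (rule words_4E)
    with y(1) show ?thesis
      by (intro exI[of _ a] exI[of _ b] exI[of _ c] exI[of _ d]) simp
  qed

  have KK: "x = y" if x: "x \<in> K s" and y: "y \<in> K t"
    and z: "z \<in> del_ball 1 x" "z \<in> del_ball 1 y" for x y z s t
  proof -
    obtain x' y' where x': "x = map (letter q s) x'" "x' \<in> C"
      and y': "y = map (letter q t) y'" "y' \<in> C"
      using x y by (auto simp: K_def)
    have "z \<in> map (letter q s) ` del_ball 1 x'" "z \<in> map (letter q t) ` del_ball 1 y'"
      using z x' y' CW del_ball_map_4[of x' q] del_ball_map_4[of y' q] by blast+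
    then obtain u v where u: "z = map (letter q s) u" "u \<in> del_ball 1 x'"
      and v: "z = map (letter q t) v" "v \<in> del_ball 1 y'"
      by blast
    have uv: "u \<in> words 3 q" "v \<in> words 3 q"
      using u v x' y' CW del_ball_4_subset_words by blast+
    \<comment> \<open>The word \<open>z\<close> reveals its half, and \<open>letter\<close> is
      injective on each half.\<close>
    then have "s = t \<and> u = v"
      using u(1) v(1) by (auto simp: words_3_eq)
    with u v x' y' disj show ?thesis by blast
  qed
  \<comment> \<open>Balls of words in \<open>K\<close> stay in one half, while a deletion from a
    word in \<open>F\<close> or \<open>G\<close> leaves letters of both.\<close>
  have KF: False if "x \<in> K s" "y \<in> F t" "z \<in> del_ball 1 x" "z \<in> del_ball 1 y" for x y z s t
    using KE[OF that(1)] FE[OF that(2)] that(3,4)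
    apply (elim exE conjE, simp only: del_ball_4)
    apply (cases s; cases t; elim insertE emptyE)
    apply (simp_all only: letter_eq_iff list.inject simp_thms)
    done
  have KG: False if "x \<in> K s" "y \<in> G t" "z \<in> del_ball 1 x" "z \<in> del_ball 1 y" for x y z s t
    using KE[OF that(1)] GE[OF that(2)] that(3,4)
    apply (elim exE conjE, simp only: del_ball_4)
    apply (cases s; cases t; elim insertE emptyE)
    apply (simp_all only: letter_eq_iff list.inject simp_thms)
    done
  \<comment> \<open>A common word exposes a pair within one half, whose colour would be both
    \<open>\<ge> q\<close> and \<open>< q\<close>.\<close>
  have FG: False if "x \<in> F s" "y \<in> G t" "z \<in> del_ball 1 x" "z \<in> del_ball 1 y" for x y z s t
    using FE[OF that(1)] GE[OF that(2)] that(3,4)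
    apply (elim exE conjE, simp only: del_ball_4)
    apply (cases s; cases t; elim insertE emptyE)
    apply (simp_all only: letter_eq_iff list.inject simp_thms)
    done
  \<comment> \<open>A common word fixes \<open>s\<close>, one whole pair, hence the colour, and one
    letter of the other pair; \<open>pack\<close> recovers that pair wherever the letter
    stood.\<close>
  have FF: "x = y" if "x \<in> F s" "y \<in> F t" "z \<in> del_ball 1 x" "z \<in> del_ball 1 y" for x y z s t
    using FE[OF that(1)] FE[OF that(2)] that(3,4)
    apply (elim exE conjE, simp only: del_ball_4)
    apply (cases s; cases t; elim insertE emptyE)
    apply (simp_all only: letter_eq_iff list.inject simp_thms)
    apply (metis pack)+
    done
  \<comment> \<open>The shape fixes \<open>s\<close>. Either both outer letters survive and fix the
    colour, so \<open>pack\<close> recovers the inner pair, or the inner pair and one outer letter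
    survive, and cancellation modulo \<open>q\<close> gives the other.\<close>
  have GG: "x = y" if "x \<in> G s" "y \<in> G t" "z \<in> del_ball 1 x" "z \<in> del_ball 1 y" for x y z s t
    using GE[OF that(1)] GE[OF that(2)] that(3,4)
    apply (elim exE conjE, simp only: del_ball_4)
    apply (cases s; cases t; elim insertE emptyE)
    apply (simp_all only: letter_eq_iff list.inject simp_thms)
    apply (metis pack add_mod_left_cancel add.commute)+
    done

  define D where "D = (\<Union>s. K s \<union> F s \<union> G s)"
  have "del_code 4 (2 * q) 1 D"
    unfolding del_code_def
  proof (intro conjI ballI impI)
    show "D \<subseteq> words 4 (2 * q)"
      unfolding D_def by (auto simp: words_def dest!: KE FE GE)
    fix x y assume "x \<in> D" "y \<in> D" "x \<noteq> y"
    from \<open>x \<in> D\<close> obtain s where s: "x \<in> K s \<or> x \<in> F s \<or> x \<in> G s" by (auto simp: D_def)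
    from \<open>y \<in> D\<close> obtain t where t: "y \<in> K t \<or> y \<in> F t \<or> y \<in> G t" by (auto simp: D_def)
    have False if z: "z \<in> del_ball 1 x" "z \<in> del_ball 1 y" for z
      using s t \<open>x \<noteq> y\<close> KK[OF _ _ z] FF[OF _ _ z] GG[OF _ _ z]
        KF[OF _ _ z] KG[OF _ _ z] FG[OF _ _ z]
        KF[OF _ _ z(2,1)] KG[OF _ _ z(2,1)] FG[OF _ _ z(2,1)] by metis
    then show "del_ball 1 x \<inter> del_ball 1 y = {}" by blast
  qed
  moreover have "card D = 2 * card C + q ^ 2 * (q - 2) div 2 + 2 * q ^ 2 + q ^ 3"
  proof -
    have "card I = (\<Sum>k\<in>{q..2 * q - 2}. card (P k \<times> P k))"
      unfolding I_def using fP by (intro card_UN_disjoint) (auto simp: P_def)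
    \<comment> \<open>The top colour is split off because the diagonal class has \<open>q\<close>
      pairs instead of \<open>q div 2\<close>.\<close>
    also have "{q..2 * q - 2} = insert (2 * q - 2) {q..<2 * q - 2}"
      using \<open>even q\<close> \<open>q > 0\<close> by (auto elim!: evenE)
    also have "(\<Sum>k\<in>\<dots>. card (P k \<times> P k)) = q * q + (\<Sum>k\<in>{q..<2 * q - 2}. card (P k \<times> P k))"
      using cardP_diag by (simp add: card_cartesian_product P_def)
    also have "(\<Sum>k\<in>{q..<2 * q - 2}. card (P k \<times> P k)) =
        (\<Sum>k\<in>{q..<2 * q - 2}. (q div 2) * (q div 2))"
      using cardP by (intro sum.cong) (auto simp: card_cartesian_product P_def)
    finally have cI: "card I = q * q + (q - 2) * ((q div 2) * (q div 2))"
      by simp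
    have "card J = (\<Sum>ab\<in>{..<q} \<times> {..<q}. card (P ((fst ab + snd ab) mod q)))"
      unfolding J_def using fP by (intro card_SigmaI) auto
    also have "\<dots> = (\<Sum>ab\<in>{..<q} \<times> {..<q}. q div 2)"
    proof (intro sum.cong refl)
      fix ab :: "nat \<times> nat"
      \<comment> \<open>This keeps all residues below the diagonal colour
        \<open>2 * q - 2\<close>.\<close>
      have "q \<ge> 2" using \<open>even q\<close> \<open>q > 0\<close> by (auto elim!: evenE)
      then have "q \<le> 2 * q - 2" by simp
      moreover have "(fst ab + snd ab) mod q < q" using \<open>q > 0\<close> by simp
      ultimately show "card (P ((fst ab + snd ab) mod q)) = q div 2"
        unfolding P_def by (intro cardP) linarith
    qed
    finally have cJ: "card J = q * q * (q div 2)" by simp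
    have fI: "finite I" unfolding I_def using fP by auto
    have fJ: "finite J" unfolding J_def using fP by auto
    have cF: "card (F s) = card I" for s
      unfolding F_def by (intro card_image) (auto simp: inj_on_def f_def I_def P_def)
    have cG: "card (G s) = card J" for s
      unfolding G_def by (intro card_image) (auto simp: inj_on_def g_def J_def P_def)
    have "inj (letter q s)" for s
      by (auto simp: inj_def letter_def)
    then have cK: "card (K s) = card C" for s
      unfolding K_def by (meson card_image inj_mapI inj_on_subset subset_UNIV)
    have fin: "finite (K s)" "finite (F s)" "finite (G s)" for s
      using fC fI fJ by (simp_all add: K_def F_def G_def)
    \<comment> \<open>With nonempty balls, a word in two families would violate \<open>KF\<close>,
      \<open>KG\<close> or \<open>FG\<close> when compared with itself.\<close>
    have ne: "\<exists>z. z \<in> del_ball 1 x" if "x \<in> D" for x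
    proof -
      have "x \<in> words 4 (2 * q)"
        using \<open>del_code 4 (2 * q) 1 D\<close> that by (auto simp: del_code_def)
      then obtain a b c d where "x = [a, b, c, d]" by (rule words_4E)
      then show ?thesis using del_ball_4 by blast
    qed
    have sub: "K s \<subseteq> D" "F s \<subseteq> D" for s by (auto simp: D_def)
    have disjI: "A \<inter> B = {}"
      if "A \<subseteq> D" "\<And>x z. x \<in> A \<Longrightarrow> x \<in> B \<Longrightarrow> z \<in> del_ball 1 x \<Longrightarrow> False" for A B
      using that ne by (meson disjoint_iff subsetD)
    have 1: "K s \<inter> F t = {}" "K s \<inter> G t = {}" "F s \<inter> G t = {}" for s t
      by (rule disjI[OF sub(1)], erule (3) KF[of _ s _ t],
          rule disjI[OF sub(1)], erule (3) KG[of _ s _ t],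
          rule disjI[OF sub(2)], erule (3) FG[of _ s _ t])
    have 2: "K False \<inter> K True = {}" "F False \<inter> F True = {}" "G False \<inter> G True = {}"
      by (auto dest!: KE FE GE)
    have "D = (K False \<union> K True) \<union> (F False \<union> F True) \<union> (G False \<union> G True)"
      unfolding D_def by (auto simp: UNIV_bool)
    also have "card \<dots> = 2 * card C + 2 * card I + 2 * card J"
      using 1 2 fin by (simp add: card_Un_disjoint Int_Un_distrib Int_Un_distrib2 cF cG cK)
    finally show ?thesis
      unfolding cI cJ using \<open>even q\<close>
      by (auto elim!: evenE simp: power2_eq_square power3_eq_cube algebra_simps)
  qed
  ultimately show thesis by (rule that)
qed

section \<open>Combining the two bounds\<close>

theorem theorem4p2:
  fixes m q :: nat
  assumes "m \<ge> 1" and "q = 6 * m"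
    and "N 4 q 1 = q ^ 2 * (q + 2) div 4"
  shows "N 4 (2 * q) 1 = (2 * q) ^ 2 * (2 * q + 2) div 4"
proof (rule antisym)
  obtain E where E: "del_code 4 (2 * q) 1 E" "card E = N 4 (2 * q) 1"
    using ex_optimal_code by blast
  have "4 * card E \<le> (2 * q) ^ 2 * (2 * q + 2)"
    using E(1) by (rule code_card_upper) simp
  then show "N 4 (2 * q) 1 \<le> (2 * q) ^ 2 * (2 * q + 2) div 4"
    using E(2) by linarith
next
  obtain C where C: "del_code 4 q 1 C" "card C = N 4 q 1"
    using ex_optimal_code by blast
  obtain D where D: "del_code 4 (2 * q) 1 D"
    "card D = 2 * card C + q ^ 2 * (q - 2) div 2 + 2 * q ^ 2 + q ^ 3"
    using code_doubling[OF C(1)] assms by auto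
  \<comment> \<open>Writing \<open>q - 2\<close> as \<open>2 * k\<close> removes natural subtraction
    and makes every division exact.\<close>
  define k where "k = 3 * m - 1"
  have k: "q = 2 * k + 2" using assms by (simp add: k_def)
  have "2 * (q ^ 2 * (q + 2) div 4) + q ^ 2 * (q - 2) div 2 + 2 * q ^ 2 + q ^ 3 =
        (2 * q) ^ 2 * (2 * q + 2) div 4"
  proof -
    have "q ^ 2 * (q + 2) = 4 * ((k + 1) ^ 2 * (q + 2))"
      "q ^ 2 * (q - 2) = 2 * (2 * (k + 1) ^ 2 * (2 * k))"
      "(2 * q) ^ 2 * (2 * q + 2) = 4 * (q ^ 2 * (2 * q + 2))"
      by (simp_all add: k power2_eq_square algebra_simps)
    then show ?thesis
      by (simp add: k power2_eq_square power3_eq_cube algebra_simps)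
  qed
  then have "card D = (2 * q) ^ 2 * (2 * q + 2) div 4"
    using D(2) C(2) assms(3) by simp
  then show "(2 * q) ^ 2 * (2 * q + 2) div 4 \<le> N 4 (2 * q) 1"
    using card_le_N[OF D(1)] by simp
qed

end
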